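(* Let $(\mathcal{X},\mathcal{A})$ be a $t$-$(v,k,1)$ design, and let $T$ be the binary matrix whose rows are indexed by the $(t-1)$-sized subsets $D$ of $\mathcal{X}$, whose columns are indexed by the pairs $(y,B)$ with $B\in\mathcal{A}$ and $y\in B$, and with $T(D,(y,B))=1$ if $D\cup\{y\}\subseteq B$ and $|D\cup\{y\}|=t$, and $T(D,(y,B))=0$ otherwise. Then $T$ forms a $\left(K=\binom{v}{t-1},\;F=\frac{\binom{v}{t}k}{\binom{k}{t}},\;(1-\frac{M}{N})=\frac{\binom{k}{t}(v-t+1)}{\binom{v}{t}k}\right)$-caching matrix. Further, there is a transmission scheme (for the caching scheme defined by $T$) with rate $R=\frac{\binom{k-1}{t-1}\binom{k}{t}v}{\binom{v}{t}k}$.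
   Context: A design is a pair $(\mathcal{X},\mathcal{A})$ with $\mathcal{X}$ a set of points and $\mathcal{A}$ a collection (multiset) of nonempty subsets of $\mathcal{X}$ called blocks. For positive integers with $v>k\geq t$, a $t$-$(v,k,1)$ design is a design with $|\mathcal{X}|=v$, each block having exactly $k$ points, and every set of $t$ distinct points contained in exactly one block. Coded caching model: a server holds $N$ files $W_1,\dots,W_N$ of equal size and is connected by an error-free broadcast link to $K$ users indexed by $\mathcal{U}$, $|\mathcal{U}|=K$. Each file $W_i$ is split into $F$ subfiles $W_{i,f}$, $f\in\mathcal{F}$, $|\mathcal{F}|=F$, of the same size and taking values in an abelian group. After the caches are filled, each user $u$ demands a file $W_{d_u}$, $d_u\in[N]$. The server broadcasts transmissions, each a linear combination (sum) of subfiles of demanded files; a transmission scheme is valid if, for all demands, every user $u$ can recover all subfiles of $W_{d_u}$ from its cache and the transmissions. The rate is $R=\frac{\text{number of transmissions}}{F}$. Caching matrix: a binary matrix $C$ with rows indexed by a $K$-set $\mathcal{U}$ and columns by an $F$-set $\mathcal{F}$, with the same number $Z$ of $1$'s in every row. It defines the caching scheme in which user $u$ caches $W_{i,f}$ for all $i\in[N]$ if $C(u,f)=0$, and does not cache it if $C(u,f)=1$; the uncached fraction is $1-\frac{M}{N}=\frac{Z}{F}$. $C$ is then called a $(K,F,(1-\frac{M}{N}))$-caching matrix. *)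

theory Defs
  imports Complex_Main "HOL-Library.Multiset" "HOL-Library.FuncSet"
begin

definition design :: "'a set \<Rightarrow> 'a set multiset \<Rightarrow> bool" where
  "design X A \<longleftrightarrow> (\<forall>B\<in>#A. B \<noteq> {} \<and> B \<subseteq> X)"

text \<open>A $t$-$(v,k,1)$ design. Blocks containing a given \<open>t\<close>-set are counted with multiplicity.\<close>

definition t_design :: "nat \<Rightarrow> nat \<Rightarrow> nat \<Rightarrow> 'a set \<Rightarrow> 'a set multiset \<Rightarrow> bool" where
  "t_design t v k X A \<longleftrightarrow>
     0 < t \<and> t \<le> k \<and> k < v \<and>
     design X A \<and> card X = v \<and>
     (\<forall>B\<in>#A. card B = k) \<and>
     (\<forall>S. S \<subseteq> X \<and> card S = t \<longrightarrow> size {#B \<in># A. S \<subseteq> B#} = 1)"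

text \<open>The rows of \<open>C\<close> are indexed by \<open>U\<close> and its columns by \<open>Fs\<close>. The parameters \<open>K\<close> and \<open>F\<close> are
  real-valued only so that closed formulas involving quotients can be used for them without
  truncating division. The parameter \<open>\<rho>\<close> is the uncached fraction \<open>1 - M/N\<close>.\<close>

definition caching_matrix ::
  "'u set \<Rightarrow> 'f set \<Rightarrow> ('u \<Rightarrow> 'f \<Rightarrow> nat) \<Rightarrow> real \<Rightarrow> real \<Rightarrow> real \<Rightarrow> bool" where
  "caching_matrix U Fs C K F \<rho> \<longleftrightarrow>
     finite U \<and> finite Fs \<and> real (card U) = K \<and> real (card Fs) = F \<and>
     (\<forall>u\<in>U. \<forall>f\<in>Fs. C u f \<in> {0, 1}) \<and>
     (\<exists>Z::nat. (\<forall>u\<in>U. card {f \<in> Fs. C u f = 1} = Z) \<and> \<rho> = real Z / F)"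

text \<open>The pair \<open>(i, f)\<close> stands for the subfile \<open>f\<close> of file \<open>i\<close>, where the files are numbered from
  \<open>1\<close> to \<open>N\<close>.\<close>

definition cache :: "'f set \<Rightarrow> ('u \<Rightarrow> 'f \<Rightarrow> nat) \<Rightarrow> nat \<Rightarrow> 'u \<Rightarrow> (nat \<times> 'f) set" where
  "cache Fs C N u = {1..N} \<times> {f \<in> Fs. C u f = 0}"

text \<open>A transmission is given by a set \<open>S\<close> of subfiles; what is broadcast is \<open>sum W S\<close>, where \<open>W\<close>
  assigns to each subfile its content in the group. A user demanding file \<open>i\<close> recovers it if a single
  decoding function, which sees only the cached part of \<open>W\<close> and the broadcast values, returns all
  subfiles of file \<open>i\<close> whatever \<open>W\<close> is.\<close>

definition can_recover ::
  "'g::ab_group_add itself \<Rightarrow> 'f set \<Rightarrow> (nat \<times> 'f) set \<Rightarrow> (nat \<times> 'f) set list \<Rightarrow> nat \<Rightarrow> bool" where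
  "can_recover _ Fs H txs i \<longleftrightarrow>
     (\<exists>dec :: (nat \<times> 'f \<Rightarrow> 'g) \<Rightarrow> 'g list \<Rightarrow> 'f \<Rightarrow> 'g.
        \<forall>W :: nat \<times> 'f \<Rightarrow> 'g. \<forall>f\<in>Fs.
          dec (restrict W H) (map (\<lambda>S. sum W S) txs) f = W (i, f))"

text \<open>A scheme \<open>tx\<close> assigns to every demand vector \<open>d\<close> a list of \<open>n\<close> transmissions.\<close>

definition valid_transmission_scheme ::
  "'g::ab_group_add itself \<Rightarrow> 'u set \<Rightarrow> 'f set \<Rightarrow> ('u \<Rightarrow> 'f \<Rightarrow> nat) \<Rightarrow> nat \<Rightarrow> nat \<Rightarrow>
     (('u \<Rightarrow> nat) \<Rightarrow> (nat \<times> 'f) set list) \<Rightarrow> bool" where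
  "valid_transmission_scheme G U Fs C N n tx \<longleftrightarrow>
     (\<forall>d \<in> U \<rightarrow> {1..N}.
        length (tx d) = n \<and>
        (\<forall>S \<in> set (tx d). S \<subseteq> d ` U \<times> Fs) \<and>
        (\<forall>u\<in>U. can_recover G Fs (cache Fs C N u) (tx d) (d u)))"

definition has_scheme_with_rate ::
  "'g::ab_group_add itself \<Rightarrow> 'u set \<Rightarrow> 'f set \<Rightarrow> ('u \<Rightarrow> 'f \<Rightarrow> nat) \<Rightarrow> nat \<Rightarrow> real \<Rightarrow> bool" where
  "has_scheme_with_rate G U Fs C N R \<longleftrightarrow>
     (\<exists>n tx. valid_transmission_scheme G U Fs C N n tx \<and> R = real n / real (card Fs))"

definition design_rows :: "nat \<Rightarrow> 'a set \<Rightarrow> 'a set set" where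
  "design_rows t X = {D. D \<subseteq> X \<and> card D = t - 1}"

text \<open>Pairing points with elements of the underlying set of \<open>A\<close> loses nothing: by uniqueness, the
  blocks of a $t$-$(v,k,1)$ design have multiplicity one.\<close>

definition design_columns :: "'a set multiset \<Rightarrow> ('a \<times> 'a set) set" where
  "design_columns A = {(y, B). B \<in># A \<and> y \<in> B}"

definition design_matrix :: "nat \<Rightarrow> 'a set \<Rightarrow> 'a \<times> 'a set \<Rightarrow> nat" where
  "design_matrix t D = (\<lambda>(y, B). if D \<union> {y} \<subseteq> B \<and> card (D \<union> {y}) = t then 1 else 0)"

end

theory Submission
  imports Defs
begin

text \<open>A transmission that adds up, over the positions of an identity submatrix of the caching matrix,
  the corresponding demanded subfiles serves every user of that submatrix, since each of them caches
  all the other summands. For a fixed point \<open>y\<close>, every \<open>(t - 1)\<close>-set avoiding \<open>y\<close> lies together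
  with \<open>y\<close> in exactly one block; enumerating, for each block \<open>B\<close> through \<open>y\<close>, the
  \<open>(k - 1) choose (t - 1)\<close> sets of size \<open>t - 1\<close> in \<open>B - {y}\<close> and collecting the \<open>j\<close>-th ones
  of all these blocks thus splits the nonzero entries in the columns \<open>(y, B)\<close> into
  \<open>(k - 1) choose (t - 1)\<close> identity submatrices.\<close>

section \<open>Delivery from identity submatrices\<close>

lemma identity_submatrix_scheme:
  fixes C :: "'u \<Rightarrow> 'f \<Rightarrow> nat" and Ps :: "('u \<times> 'f) set list"
  assumes fin: "finite U" "finite Fs"
    and sub: "\<And>P. P \<in> set Ps \<Longrightarrow> P \<subseteq> U \<times> Fs"
    and ident: "\<And>P u f u' f'. P \<in> set Ps \<Longrightarrow> (u, f) \<in> P \<Longrightarrow> (u', f') \<in> P \<Longrightarrow>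
      (u, f) \<noteq> (u', f') \<Longrightarrow> f \<noteq> f' \<and> C u f' = 0"
    and cover: "\<And>u f. u \<in> U \<Longrightarrow> f \<in> Fs \<Longrightarrow> C u f \<noteq> 0 \<Longrightarrow> \<exists>P\<in>set Ps. (u, f) \<in> P"
  shows "valid_transmission_scheme TYPE('g::ab_group_add) U Fs C N (length Ps)
    (\<lambda>d. map (\<lambda>P. (\<lambda>(u, f). (d u, f)) ` P) Ps)"
  unfolding valid_transmission_scheme_def
proof (intro ballI conjI)
  fix d assume d: "d \<in> U \<rightarrow> {1..N}"
  let ?S = "\<lambda>P. (\<lambda>(u, f). (d u, f)) ` P"
  let ?txs = "map ?S Ps"
  show "length ?txs = length Ps" by simp
  fix S assume "S \<in> set ?txs"
  then show "S \<subseteq> d ` U \<times> Fs" using sub by fastforce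
next
  fix d u assume d: "d \<in> U \<rightarrow> {1..N}" and u: "u \<in> U"
  let ?S = "\<lambda>P. (\<lambda>(u, f). (d u, f)) ` P"
  let ?txs = "map ?S Ps"
  let ?H = "cache Fs C N u"
  have "\<exists>j. j < length Ps \<and> (u, f) \<in> Ps ! j" if "f \<in> Fs" "C u f \<noteq> 0" for f
    using cover[OF u that] by (metis in_set_conv_nth)
  \<comment> \<open>The decoder sees the broadcast values only as a list, so it must know at which
    position a submatrix containing the entry \<open>(u, f)\<close> stands.\<close>
  then obtain idx where idx: "\<And>f. f \<in> Fs \<Longrightarrow> C u f \<noteq> 0 \<Longrightarrow> idx f < length Ps \<and> (u, f) \<in> Ps ! idx f"
    by metis
  \<comment> \<open>A cached subfile is read off directly. For a missing one, the other summands are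
    subtracted from the broadcast sum.\<close>
  define dec :: "(nat \<times> 'f \<Rightarrow> 'g) \<Rightarrow> 'g list \<Rightarrow> 'f \<Rightarrow> 'g" where
    "dec = (\<lambda>w bs f. if C u f = 0 then w (d u, f)
      else bs ! idx f - sum w (?S (Ps ! idx f) - {(d u, f)}))"
  have "dec (restrict W ?H) (map (sum W) ?txs) f = W (d u, f)" if f: "f \<in> Fs" for W f
  proof (cases "C u f = 0")
    case True
    then show ?thesis using d u f by (auto simp: dec_def cache_def)
  next
    case False
    define P where "P = Ps ! idx f"
    have j: "idx f < length Ps" and uf: "(u, f) \<in> P" and P: "P \<in> set Ps"
      using idx[OF f False] by (auto simp: P_def)
    have "finite P" using sub[OF P] fin by (meson finite_SigmaI finite_subset)
    then have "sum W (?S P) = W (d u, f) + sum W (?S P - {(d u, f)})"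
      using uf by (intro sum.remove) force+
    \<comment> \<open>A different summand comes from a different entry of \<open>P\<close>, in whose
      column row \<open>u\<close> has a zero. Hence the decoder subtracts only values that
      \<open>restrict\<close> leaves intact.\<close>
    moreover have "?S P - {(d u, f)} \<subseteq> ?H"
    proof
      fix x assume x: "x \<in> ?S P - {(d u, f)}"
      then obtain u' f' where *: "(u', f') \<in> P" "x = (d u', f')" "(u, f) \<noteq> (u', f')" by auto
      then have "C u f' = 0" "u' \<in> U" "f' \<in> Fs"
        using ident[OF P uf *(1)] sub[OF P] by auto
      then show "x \<in> ?H" using * d by (auto simp: cache_def)
    qed
    then have "sum (restrict W ?H) (?S P - {(d u, f)}) = sum W (?S P - {(d u, f)})"
      by (intro sum.cong) auto
    ultimately show ?thesis using False j by (simp add: dec_def flip: P_def)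
  qed
  then show "can_recover TYPE('g) Fs ?H ?txs (d u)"
    unfolding can_recover_def by (intro exI[of _ dec]) blast
qed

section \<open>Counting blocks, columns and the ones in a row\<close>

lemma t_design_finite:
  assumes "t_design t v k X A"
  shows "finite X"
  using assms by (auto simp: t_design_def intro: card_ge_0_finite)

lemma t_design_block:
  assumes "t_design t v k X A" "B \<in># A"
  shows "B \<subseteq> X" "card B = k" "finite B"
proof -
  show "B \<subseteq> X" "card B = k" using assms by (auto simp: t_design_def design_def)
  then show "finite B" using t_design_finite[OF assms(1)] finite_subset by blast
qed

lemma t_design_ex1_block:
  assumes "t_design t v k X A" "S \<subseteq> X" "card S = t"
  shows "\<exists>!B. B \<in># A \<and> S \<subseteq> B"
proof -
  have "size {#B \<in># A. S \<subseteq> B#} = 1" using assms by (auto simp: t_design_def)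
  then obtain B where "{#B \<in># A. S \<subseteq> B#} = {#B#}" using size_1_singleton_mset by blast
  then have "set_mset {#B \<in># A. S \<subseteq> B#} = {B}" by simp
  then have "{B'. B' \<in># A \<and> S \<subseteq> B'} = {B}" by simp
  then show ?thesis by (metis (mono_tags, lifting) mem_Collect_eq singletonD singletonI)
qed

text \<open>Double counting: each \<open>t\<close>-subset of \<open>X\<close> lies in exactly one
  block, so the families of \<open>t\<close>-subsets of the individual blocks partition the
  \<open>t\<close>-subsets of \<open>X\<close>.\<close>

lemma card_blocks:
  assumes des: "t_design t v k X A"
  shows "card (set_mset A) * (k choose t) = v choose t"
proof -
  let ?sub = "\<lambda>B. {S. S \<subseteq> B \<and> card S = t}"
  have "?sub X = (\<Union>B\<in>set_mset A. ?sub B)"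
  proof (intro equalityI subsetI)
    fix S assume "S \<in> ?sub X"
    with t_design_ex1_block[OF des, of S] show "S \<in> (\<Union>B\<in>set_mset A. ?sub B)" by auto
  qed (use t_design_block(1)[OF des] in fastforce)
  moreover have "card (\<Union>B\<in>set_mset A. ?sub B) = (\<Sum>B\<in>set_mset A. card (?sub B))"
  proof (rule card_UN_disjoint)
    show "\<forall>B\<in>set_mset A. \<forall>B'\<in>set_mset A. B \<noteq> B' \<longrightarrow> ?sub B \<inter> ?sub B' = {}"
    proof (intro ballI impI)
      fix B B' assume *: "B \<in># A" "B' \<in># A" "B \<noteq> B'"
      have False if S: "S \<subseteq> B" "S \<subseteq> B'" "card S = t" for S
      proof -
        have "S \<subseteq> X" using t_design_block(1)[OF des *(1)] S by blast
        from t_design_ex1_block[OF des this S(3)] S * show False by blast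
      qed
      then show "?sub B \<inter> ?sub B' = {}" by blast
    qed
  qed (use t_design_block[OF des] in auto)
  moreover have "(\<Sum>B\<in>set_mset A. card (?sub B)) = card (set_mset A) * (k choose t)"
    using t_design_block[OF des] by (simp add: n_subsets)
  moreover have "card (?sub X) = v choose t"
    using n_subsets[OF t_design_finite[OF des]] des by (simp add: t_design_def)
  ultimately show ?thesis by simp
qed

text \<open>The swap puts the block first, since the range of the point depends on it; the
  cardinality rule for dependent sums then applies.\<close>

lemma design_columns_Sigma: "design_columns A = (\<lambda>(B, y). (y, B)) ` (SIGMA B:set_mset A. B)"
  by (auto simp: design_columns_def)

lemma card_design_columns:
  assumes des: "t_design t v k X A"
  shows "finite (design_columns A)" "card (design_columns A) = card (set_mset A) * k"
proof -
  show "finite (design_columns A)"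
    using t_design_block[OF des] by (auto simp: design_columns_Sigma)
  have "inj_on (\<lambda>(B, y). (y, B)) (SIGMA B:set_mset A. B)" by (auto simp: inj_on_def)
  then show "card (design_columns A) = card (set_mset A) * k"
    using t_design_block[OF des]
    by (simp add: design_columns_Sigma card_image)
qed

text \<open>Since \<open>D\<close> is finite with \<open>t - 1\<close> elements and \<open>t\<close>
  is positive, adding \<open>y\<close> gives \<open>t\<close> elements exactly when \<open>y\<close>
  is new.\<close>

lemma design_matrix_nonzero_iff:
  assumes "D \<in> design_rows t X" "0 < t" "finite X"
  shows "design_matrix t D (y, B) \<noteq> 0 \<longleftrightarrow> y \<notin> D \<and> insert y D \<subseteq> B"
proof -
  have "finite D" using assms by (auto simp: design_rows_def intro: finite_subset)
  then show ?thesis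
    using assms by (auto simp: design_matrix_def design_rows_def card_insert_if)
qed

text \<open>Projecting a column to its point is a bijection from the ones in row \<open>D\<close>
  onto \<open>X - D\<close>: each point \<open>y\<close> outside \<open>D\<close> completes
  \<open>D\<close> to a \<open>t\<close>-set, and the block containing this set is unique.\<close>

lemma card_design_matrix_row:
  assumes des: "t_design t v k X A" and D: "D \<in> design_rows t X"
  shows "card {f \<in> design_columns A. design_matrix t D f = 1} = v - (t - 1)"
proof -
  let ?Z = "{f \<in> design_columns A. design_matrix t D f = 1}"
  have fin: "finite X" "finite D" and t: "0 < t" and DX: "D \<subseteq> X" "card D = t - 1"
    using t_design_finite[OF des] D des
    by (auto simp: design_rows_def t_design_def intro: finite_subset)
  have Z: "(y, B) \<in> ?Z \<longleftrightarrow> B \<in># A \<and> y \<notin> D \<and> insert y D \<subseteq> B" for y B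
    using design_matrix_nonzero_iff[OF D t fin(1), of y B]
    by (auto simp: design_columns_def design_matrix_def split: if_splits)
  have ex1: "\<exists>!B. B \<in># A \<and> insert y D \<subseteq> B" if "y \<in> X - D" for y
    using t_design_ex1_block[OF des, of "insert y D"] that fin t DX by auto
  have ZX: "y \<in> X - D" if "(y, B) \<in> ?Z" for y B
    using that t_design_block(1)[OF des] unfolding Z by blast
  have "fst ` ?Z = X - D"
  proof (intro equalityI subsetI)
    fix y assume "y \<in> X - D"
    with ex1 obtain B where "(y, B) \<in> ?Z" unfolding Z by blast
    then show "y \<in> fst ` ?Z" by (rule image_eqI[rotated]) simp
  qed (use ZX in force)
  moreover have "inj_on fst ?Z"
  proof (rule inj_onI, clarify)
    fix y B y' B' assume *: "(y, B) \<in> design_columns A" "design_matrix t D (y, B) = 1"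
      "(y', B') \<in> design_columns A" "design_matrix t D (y', B') = 1"
      "fst (y, B) = fst (y', B')"
    then have yB: "(y, B) \<in> ?Z" "(y, B') \<in> ?Z" by auto
    from ex1[OF ZX[OF yB(1)]] yB have "B = B'" unfolding Z by blast
    then show "y = y' \<and> B = B'" using * by simp
  qed
  ultimately have "card ?Z = card (X - D)" by (metis card_image)
  then show ?thesis using des DX fin by (simp add: card_Diff_subset t_design_def)
qed

section \<open>Splitting the matrix of a design into identity submatrices\<close>

lemma design_transmission_scheme:
  fixes X :: "'a set" and A :: "'a set multiset"
  assumes des: "t_design t v k X A"
  shows "\<exists>tx. valid_transmission_scheme TYPE('g::ab_group_add)
    (design_rows t X) (design_columns A) (design_matrix t) N (v * ((k - 1) choose (t - 1))) tx"
proof -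
  have X: "finite X" "card X = v" and t: "0 < t"
    using t_design_finite[OF des] des by (auto simp: t_design_def)
  let ?m = "(k - 1) choose (t - 1)"
  let ?sub = "\<lambda>y B. {D. D \<subseteq> B - {y} \<and> card D = t - 1}"
  have ex: "\<exists>h. bij_betw h {0..<?m} (?sub y B)" if "B \<in># A" "y \<in> B" for y B
  proof -
    have "finite (B - {y})" "card (B - {y}) = k - 1"
      using t_design_block[OF des that(1)] that(2) by auto
    then have "finite (?sub y B)" "card (?sub y B) = ?m"
      by (simp_all add: n_subsets)
    then show ?thesis by (metis ex_bij_betw_nat_finite)
  qed
  \<comment> \<open>The enumerations are chosen independently for each pair of a point and a block;
    no compatibility between different blocks is required.\<close>
  define e where "e = (\<lambda>(y :: 'a) B. SOME h. bij_betw h {0..<?m} (?sub y B))"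
  have e: "bij_betw (e y B) {0..<?m} (?sub y B)" if "B \<in># A" "y \<in> B" for y B
    using someI_ex[OF ex[OF that]] unfolding e_def .
  obtain xs where xs: "set xs = X" "distinct xs" using finite_distinct_list[OF X(1)] by blast
  \<comment> \<open>One entry for each block through \<open>y\<close>, so the columns within
    \<open>P (y, j)\<close> are told apart by their blocks.\<close>
  define P where "P = (\<lambda>(y, j). {(e y B j, (y, B)) | B. B \<in># A \<and> y \<in> B})"
  define Ps where "Ps = map P (List.product xs [0..<?m])"
  have row: "e y B j \<in> design_rows t X" "y \<notin> e y B j" "e y B j \<subseteq> B"
    if "B \<in># A" "y \<in> B" "j < ?m" for y B j
    using bij_betw_apply[OF e[OF that(1,2)], of j] that t_design_block(1)[OF des that(1)]
    by (auto simp: design_rows_def)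
  have unique: "B = B'" if "B \<in># A" "B' \<in># A" "D \<in> design_rows t X" "y \<notin> D"
    "insert y D \<subseteq> B" "insert y D \<subseteq> B'" for y B B' D
  proof -
    have "finite D" "insert y D \<subseteq> X" "card D = t - 1"
      using that X t_design_block(1)[OF des that(1)]
      by (auto simp: design_rows_def intro: finite_subset)
    then have "card (insert y D) = t" using that t by simp
    from t_design_ex1_block[OF des \<open>insert y D \<subseteq> X\<close> this] that show ?thesis by blast
  qed
  have len: "length Ps = v * ?m"
    using xs X by (simp add: Ps_def length_product distinct_card[symmetric])
  have inPs: "\<exists>y j. j < ?m \<and> Q = P (y, j)" if "Q \<in> set Ps" for Q
  proof -
    from that obtain p where p: "p \<in> set (List.product xs [0..<?m])" "Q = P p"
      unfolding Ps_def by (metis image_iff set_map)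
    obtain y j where "p = (y, j)" by (cases p)
    with p show ?thesis by auto
  qed
  have "valid_transmission_scheme TYPE('g) (design_rows t X) (design_columns A) (design_matrix t) N
    (length Ps) (\<lambda>d. map (\<lambda>P. (\<lambda>(u, f). (d u, f)) ` P) Ps)"
  proof (rule identity_submatrix_scheme)
    show "finite (design_rows t X)" using X by (simp add: design_rows_def)
    show "finite (design_columns A)" by (rule card_design_columns[OF des])
    show "Q \<subseteq> design_rows t X \<times> design_columns A" if Q: "Q \<in> set Ps" for Q
      using inPs[OF Q] row by (auto simp: P_def design_columns_def)
    show "f \<noteq> f' \<and> design_matrix t D f' = 0"
      if Q: "Q \<in> set Ps" and "(D, f) \<in> Q" "(D', f') \<in> Q" "(D, f) \<noteq> (D', f')" for Q D f D' f'
    proof -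
      obtain y j where j: "j < ?m" "Q = P (y, j)" using inPs[OF Q] by blast
      with that obtain B B' where *: "B \<in># A" "y \<in> B" "D = e y B j" "f = (y, B)"
        "B' \<in># A" "y \<in> B'" "D' = e y B' j" "f' = (y, B')" by (auto simp: P_def)
      with that have ne: "B \<noteq> B'" by auto
      \<comment> \<open>The \<open>t\<close>-set \<open>insert y D\<close> already lies in
        \<open>B\<close>; lying in \<open>B'\<close> as well would force the two blocks to
        coincide.\<close>
      have "\<not> insert y D \<subseteq> B'"
        using unique[OF *(1,5) row(1,2)[OF *(1,2) j(1)]] row[OF *(1,2) j(1)] * ne by auto
      then have "design_matrix t D f' = 0" by (simp add: design_matrix_def *)
      then show ?thesis using ne * by simp
    qed
    show "\<exists>Q\<in>set Ps. (D, f) \<in> Q"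
      if D: "D \<in> design_rows t X" and f: "f \<in> design_columns A" "design_matrix t D f \<noteq> 0" for D f
    proof -
      obtain y B where yB: "f = (y, B)" "B \<in># A" "y \<in> B"
        using f by (auto simp: design_columns_def)
      have "y \<notin> D" "D \<subseteq> B"
        using design_matrix_nonzero_iff[OF D t X(1)] f yB by auto
      then have "D \<in> ?sub y B" using D by (auto simp: design_rows_def)
      \<comment> \<open>The submatrix covering the entry is found from the position of
        \<open>D\<close> in the enumeration for \<open>y\<close> and \<open>B\<close>.\<close>
      then have "D \<in> e y B ` {0..<?m}"
        using bij_betw_imp_surj_on[OF e[OF yB(2,3)]] by blast
      then obtain j where j: "j < ?m" "D = e y B j" by auto
      have "y \<in> X" using t_design_block(1)[OF des] yB by blast
      then have "P (y, j) \<in> set Ps" using j xs by (auto simp: Ps_def)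
      moreover have "(D, f) \<in> P (y, j)" using j yB by (auto simp: P_def)
      ultimately show ?thesis by blast
    qed
  qed
  then show ?thesis unfolding len by blast
qed

theorem theorem3:
  fixes X :: "'a set" and A :: "'a set multiset" and t v k N :: nat
  assumes "t_design t v k X A" and "N \<ge> 1"
  shows "caching_matrix (design_rows t X) (design_columns A) (design_matrix t)
           (real (v choose (t - 1)))
           (real (v choose t) * real k / real (k choose t))
           (real (k choose t) * (real v - real t + 1) / (real (v choose t) * real k))
       \<and> has_scheme_with_rate TYPE('g::ab_group_add)
           (design_rows t X) (design_columns A) (design_matrix t) N
           (real ((k - 1) choose (t - 1)) * real (k choose t) * real v
              / (real (v choose t) * real k))"
proof -
  note des = assms(1)
  have X: "finite X" "card X = v" and t: "0 < t" "t \<le> k" "k < v"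
    using t_design_finite[OF des] des by (auto simp: t_design_def)
  \<comment> \<open>This allows solving the double count for the number of blocks, which times
    \<open>k\<close> is the number of columns.\<close>
  have "0 < k choose t" using t by simp
  moreover have "real (card (set_mset A)) * real (k choose t) = real (v choose t)"
    using card_blocks[OF des] by (metis of_nat_mult)
  ultimately have F: "real (card (design_columns A)) = real (v choose t) * real k / real (k choose t)"
    by (simp add: card_design_columns(2)[OF des] field_simps)
  have "caching_matrix (design_rows t X) (design_columns A) (design_matrix t)
           (real (v choose (t - 1)))
           (real (v choose t) * real k / real (k choose t))
           (real (k choose t) * (real v - real t + 1) / (real (v choose t) * real k))"
    unfolding caching_matrix_def
  proof (intro conjI exI[of _ "v - (t - 1)"] ballI)
    show "finite (design_rows t X)" using X by (simp add: design_rows_def)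
    show "real (card (design_rows t X)) = real (v choose (t - 1))"
      using n_subsets[OF X(1)] X(2) by (simp add: design_rows_def)
    \<comment> \<open>Because 1 \<le> t < v, neither natural subtraction in
      \<open>v - (t - 1)\<close> truncates.\<close>
    show "real (k choose t) * (real v - real t + 1) / (real (v choose t) * real k) =
      real (v - (t - 1)) / (real (v choose t) * real k / real (k choose t))"
      using t by (simp add: of_nat_diff)
  qed (use F card_design_columns[OF des] card_design_matrix_row[OF des] in
      \<open>auto simp: design_matrix_def\<close>)
  moreover obtain tx where "valid_transmission_scheme TYPE('g) (design_rows t X) (design_columns A)
      (design_matrix t) N (v * ((k - 1) choose (t - 1))) tx"
    using design_transmission_scheme[OF des] by blast
  then have "has_scheme_with_rate TYPE('g)
           (design_rows t X) (design_columns A) (design_matrix t) N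
           (real ((k - 1) choose (t - 1)) * real (k choose t) * real v
              / (real (v choose t) * real k))"
    unfolding has_scheme_with_rate_def F
    by (intro exI[of _ "v * ((k - 1) choose (t - 1))"] exI[of _ tx]) (simp add: mult_ac)
  ultimately show ?thesis ..
qed

end
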